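(* Let $r\ge1$ be an integer and $f\in\mathcal{C}^{(r)}(\mathbb{R}^+)$. Put $A=M_0(\chi)\hat M_r(\phi)+M_r(\chi)\hat M_0(\phi)$ and $B=M_0(\chi)\hat M_{r+1}(\phi)+M_{r+1}(\chi)\hat M_0(\phi)$. Then for every $x\in\mathbb{R}^+$ and $w>0$ $$\left|(I_w^{\chi,\phi}f)(x)-f(x)-\sum_{j=1}^r\frac{\theta^jf(x)}{j!\,w^j}\left(\sum_{\eta=0}^j\binom{j}{\eta}\hat m_{j-\eta}(\phi)\,m_\eta(\chi,x^w)\right)\right|\le\frac{2^rA}{r!\,w^r}\,\hat K\!\left(\theta^rf,\frac{1}{(r+1)w}\frac BA\right).$$
   Context: $\mathbb{R}^+=(0,\infty)$ carries the measure $d\mu=dt/t$. The kernels are a continuous function $\chi:\mathbb{R}^+\to\mathbb{R}$ and a function $\phi:\mathbb{R}^+\to\mathbb{R}$ with $\phi\in L^1(\mu)$. For $\nu\in\mathbb{N}_0$ put $$m_\nu(\chi,u)=\sum_{k\in\mathbb{Z}}\chi(e^{-k}u)(k-\log u)^\nu,\quad M_\nu(\chi)=\sup_{u\in\mathbb{R}^+}\sum_{k\in\mathbb{Z}}|\chi(e^{-k}u)||k-\log u|^\nu,$$ $$\hat m_\nu(\phi)=\int_0^\infty\phi(u)\log^\nu u\,\frac{du}{u},\quad \hat M_\nu(\phi)=\int_0^\infty|\phi(u)||\log u|^\nu\frac{du}{u}.$$ Standing assumptions on the kernels: (K1) for every $u\in\mathbb{R}^+$, $\sum_{k\in\mathbb{Z}}\chi(e^{-k}u)=1$,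 and $\int_0^\infty\phi(u)\frac{du}{u}=1$; (K2) for the given $r$, $M_r(\chi)+\hat M_r(\phi)<\infty$ and $\lim_{\gamma\to\infty}\sum_{|k-\log u|>\gamma}|\chi(e^{-k}u)||k-\log u|^r=0$ uniformly in $u\in\mathbb{R}^+$. Moreover $M_{r+1}(\chi)$ and $\hat M_{r+1}(\phi)$ are finite, so that $B$ is finite. The Durrmeyer type exponential sampling series is, for $w>0$ and $x\in\mathbb{R}^+$, $$(I_w^{\chi,\phi}f)(x)=\sum_{k\in\mathbb{Z}}\chi(e^{-k}x^w)\,w\int_0^\infty\phi(e^{-k}t^w)f(t)\frac{dt}{t}.$$ The Mellin derivative is $\theta f(x)=xf'(x)$, with $\theta^1=\theta$ and $\theta^j=\theta(\theta^{j-1})$. A function $f$ is log-uniformly continuous if for every $\epsilon>0$ there is $\delta>0$ with $|f(u)-f(v)|<\epsilon$ whenever $|\log u-\log v|<\delta$. $\mathcal{C}(\mathbb{R}^+)$ is the space of bounded log-uniformly continuous functions on $\mathbb{R}^+$; $\mathcal{C}^{(r)}(\mathbb{R}^+)$ is the space of (real-valued) functions that are $r$ times continuously Mellin differentiable with $\theta^rf\in\mathcal{C}(\mathbb{R}^+)$. $\|\cdot\|_\infty$ is the supremum norm. For $f\in\mathcal{C}^{(r)}(\mathbb{R}^+)$ and $\epsilon\ge0$, Peetre's K-functional is $$\hat K(\theta^rf,\epsilon)=\inf\{\|\theta^r(f-g)\|_\infty+\epsilon\|\theta^{r+1}g\|_\infty:\ g\in\mathcal{C}^{(r+1)}(\mathbb{R}^+)\}.$$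 *)

theory Defs
  imports "HOL-Analysis.Analysis"
begin

text \<open>
  Functions on the positive half-line are total functions on \<open>real\<close>; no definition below depends
  on values outside \<open>{0<..}\<close>. Quantities that may be infinite take values in \<open>ennreal\<close>.
\<close>

definition mellin_measure :: "real measure" where
  "mellin_measure = density (lebesgue_on {0<..}) (\<lambda>t. ennreal (1 / t))"

definition moment :: "nat \<Rightarrow> (real \<Rightarrow> real) \<Rightarrow> real \<Rightarrow> real" where
  "moment \<nu> chi u = (\<Sum>\<^sub>\<infinity>k\<in>(UNIV :: int set).
     chi (exp (- of_int k) * u) * (of_int k - ln u) ^ \<nu>)"

definition abs_moment :: "nat \<Rightarrow> (real \<Rightarrow> real) \<Rightarrow> ennreal" where
  "abs_moment \<nu> chi = (SUP u\<in>{0<..}. \<Sum>\<^sub>\<infinity>k\<in>(UNIV :: int set).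
     ennreal (\<bar>chi (exp (- of_int k) * u)\<bar> * \<bar>of_int k - ln u\<bar> ^ \<nu>))"

definition int_moment :: "nat \<Rightarrow> (real \<Rightarrow> real) \<Rightarrow> real" where
  "int_moment \<nu> phi = (\<integral>u. phi u * ln u ^ \<nu> \<partial>mellin_measure)"

definition int_abs_moment :: "nat \<Rightarrow> (real \<Rightarrow> real) \<Rightarrow> ennreal" where
  "int_abs_moment \<nu> phi = (\<integral>\<^sup>+u. ennreal (\<bar>phi u\<bar> * \<bar>ln u\<bar> ^ \<nu>) \<partial>mellin_measure)"

definition durrmeyer_sampling ::
  "(real \<Rightarrow> real) \<Rightarrow> (real \<Rightarrow> real) \<Rightarrow> real \<Rightarrow> (real \<Rightarrow> real) \<Rightarrow> real \<Rightarrow> real" where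
  "durrmeyer_sampling chi phi w f x = (\<Sum>\<^sub>\<infinity>k\<in>(UNIV :: int set).
     chi (exp (- of_int k) * x powr w) *
       (w * (\<integral>t. phi (exp (- of_int k) * t powr w) * f t \<partial>mellin_measure)))"

definition mellin_deriv :: "(real \<Rightarrow> real) \<Rightarrow> real \<Rightarrow> real" where
  "mellin_deriv f x = x * deriv f x"

definition log_uniformly_continuous :: "(real \<Rightarrow> real) \<Rightarrow> bool" where
  "log_uniformly_continuous f \<longleftrightarrow>
     (\<forall>\<epsilon>>0. \<exists>\<delta>>0. \<forall>u>0. \<forall>v>0. \<bar>ln u - ln v\<bar> < \<delta> \<longrightarrow> \<bar>f u - f v\<bar> < \<epsilon>)"

definition log_C :: "(real \<Rightarrow> real) set" where
  "log_C = {f. bounded (f ` {0<..}) \<and> log_uniformly_continuous f}"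

text \<open>Only the top derivative is required to be bounded and log-uniformly continuous.\<close>

definition mellin_C :: "nat \<Rightarrow> (real \<Rightarrow> real) set" where
  "mellin_C r = {f.
     (\<forall>j<r. \<forall>x>0. (mellin_deriv ^^ j) f field_differentiable (at x)) \<and>
     (\<forall>j\<le>r. continuous_on {0<..} ((mellin_deriv ^^ j) f)) \<and>
     (mellin_deriv ^^ r) f \<in> log_C}"

definition sup_norm :: "(real \<Rightarrow> real) \<Rightarrow> ennreal" where
  "sup_norm f = (SUP x\<in>{0<..}. ennreal \<bar>f x\<bar>)"

text \<open>
  \<open>peetre_K r f \<epsilon>\<close> is the K-functional of the \<open>r\<close>-th Mellin derivative of \<open>f\<close>. For admissible
  \<open>g\<close> the \<open>r\<close>-th Mellin derivative of \<open>f - g\<close> may be unbounded; such \<open>g\<close> contribute \<open>\<infinity>\<close> to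
  the infimum.
\<close>

definition peetre_K :: "nat \<Rightarrow> (real \<Rightarrow> real) \<Rightarrow> ennreal \<Rightarrow> ennreal" where
  "peetre_K r f \<epsilon> = (INF g\<in>mellin_C (r + 1).
     sup_norm ((mellin_deriv ^^ r) (\<lambda>t. f t - g t)) +
     \<epsilon> * sup_norm ((mellin_deriv ^^ (r + 1)) g))"

end

theory Submission
  imports Defs
begin

text \<open>
  In the logarithmic variable the operator \<open>f \<mapsto> durrmeyer_sampling chi phi w f x\<close> averages \<open>f\<close>
  around \<open>x\<close>. The substitution \<open>u = exp (- k) * t powr w\<close> turns the \<open>k\<close>-th integral into the
  integral of \<open>phi u * f t\<close> with \<open>ln t - ln x = (ln u + d) / w\<close> and \<open>d = k - ln (x powr w)\<close>
  (\<open>mellin_power_substitution\<close>). Mellin differentiation is ordinary differentiation in the variable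
  \<open>ln t\<close>, so Taylor's formula expands \<open>f t\<close> in powers of \<open>(ln u + d) / w\<close>. By the binomial theorem,
  the \<open>j\<close>-th Taylor term produces precisely the combination of products of moments of \<open>phi\<close> and
  \<open>chi\<close> in the statement. The term \<open>j = 0\<close> equals \<open>f x\<close>, since both moments of order \<open>0\<close> are \<open>1\<close>.

  It remains to bound the averaged Taylor remainder. For a smoother function \<open>g\<close>, write
  \<open>f = (f - g) + g\<close>. The remainder of \<open>f - g\<close> of order \<open>r\<close> is at most
  \<open>2 * \<alpha> / r! * \<bar>ln t - ln x\<bar> ^ r\<close>, where \<open>\<alpha>\<close> bounds its \<open>r\<close>-th Mellin derivative, and that of
  \<open>g\<close> is at most \<open>\<beta> / (r + 1)! * \<bar>ln t - ln x\<bar> ^ (r + 1)\<close>, where \<open>\<beta>\<close> bounds its derivative of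
  order \<open>r + 1\<close> (\<open>mellin_taylor_smoothing_bound\<close>). Convexity of powers,
  \<open>\<bar>a + b\<bar> ^ n \<le> 2 ^ (n - 1) * (\<bar>a\<bar> ^ n + \<bar>b\<bar> ^ n)\<close>, separates the variable \<open>u\<close> from the index
  \<open>k\<close>, and integrating and summing gives \<open>A\<close> from the first remainder and \<open>B\<close> from the second
  (\<open>infsum_power_moment_expansion_error\<close>). The factor \<open>2 ^ r\<close> common to both is \<open>2 * 2 ^ (r - 1)\<close> in
  the first case and the convexity constant for exponent \<open>r + 1\<close> in the second.

  The infimum over \<open>g\<close> then gives the K-functional, as soon as \<open>A\<close> can be cancelled in
  \<open>A * (B / A)\<close>. Here \<open>A\<close> is finite because boundedness of \<open>chi\<close> on a compact interval around \<open>1\<close>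
  controls the few terms of the moment of order \<open>0\<close> that the moment of order \<open>r\<close> does not dominate
  (\<open>abs_moment_zero_finite\<close>), and \<open>A\<close> is positive because both kernels have total mass \<open>1\<close>.
\<close>

section \<open>Integration against the Mellin measure\<close>

lemma space_mellin [simp]: "space mellin_measure = {0<..}"
  by (simp add: mellin_measure_def)

lemma continuous_imp_measurable_mellin:
  assumes "continuous_on {0<..} h"
  shows "h \<in> borel_measurable mellin_measure"
  using continuous_imp_measurable_on_sets_lebesgue[OF assms] by (simp add: mellin_measure_def)

text \<open>
  The change-of-variables theorem is about Lebesgue integrals over subsets of the line; this
  equivalence and the next lemma carry it over to \<open>mellin_measure\<close>.
\<close>

lemma mellin_integrable_iff:
  fixes h :: "real \<Rightarrow> real"
  shows "integrable mellin_measure h \<longleftrightarrow> (\<lambda>t. h t / t) absolutely_integrable_on {0<..}"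
proof -
  have inv: "(\<lambda>t::real. 1 / t) \<in> borel_measurable (lebesgue_on {0<..})"
    and idm: "(\<lambda>t::real. t) \<in> borel_measurable (lebesgue_on {0<..})"
    by (rule continuous_imp_measurable_on_sets_lebesgue; auto intro!: continuous_intros)+
  have *: "integrable mellin_measure h \<longleftrightarrow> integrable (lebesgue_on {0<..}) (\<lambda>t. h t / t)"
    if "h \<in> borel_measurable (lebesgue_on {0<..})"
    unfolding mellin_measure_def
    by (subst integrable_density) (use that inv in \<open>auto intro!: AE_I2\<close>)
  have m: "h \<in> borel_measurable (lebesgue_on {0<..})" if "integrable mellin_measure h"
    using borel_measurable_integrable[OF that] by (simp add: mellin_measure_def)
  have m': "h \<in> borel_measurable (lebesgue_on {0<..})"
    if i: "integrable (lebesgue_on {0<..}) (\<lambda>t. h t / t)"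
  proof -
    have "(\<lambda>t. t * (h t / t)) \<in> borel_measurable (lebesgue_on {0<..})"
      by (intro borel_measurable_times idm borel_measurable_integrable i)
    moreover have "(\<lambda>t. t * (h t / t)) \<in> borel_measurable (lebesgue_on {0<..}) \<longleftrightarrow>
        h \<in> borel_measurable (lebesgue_on {0<..})"
      by (rule measurable_cong) auto
    ultimately show ?thesis by simp
  qed
  have "integrable (lebesgue_on {0<..}) (\<lambda>t. h t / t) \<longleftrightarrow> (\<lambda>t. h t / t) absolutely_integrable_on {0<..}"
    by (simp add: set_integrable_def integrable_restrict_space)
  with * m m' show ?thesis by blast
qed

lemma mellin_integral_eq:
  fixes h :: "real \<Rightarrow> real"
  assumes "integrable mellin_measure h"
  shows "integral\<^sup>L mellin_measure h = integral {0<..} (\<lambda>t. h t / t)"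
proof -
  have inv: "(\<lambda>t::real. 1 / t) \<in> borel_measurable (lebesgue_on {0<..})"
    by (rule continuous_imp_measurable_on_sets_lebesgue; auto intro!: continuous_intros)
  have m: "h \<in> borel_measurable (lebesgue_on {0<..})"
    using borel_measurable_integrable[OF assms] by (simp add: mellin_measure_def)
  have "integral\<^sup>L mellin_measure h = integral\<^sup>L (lebesgue_on {0<..}) (\<lambda>t. h t / t)"
    unfolding mellin_measure_def
    by (subst integral_density) (use m inv in \<open>auto intro!: AE_I2\<close>)
  also have "\<dots> = integral {0<..} (\<lambda>t. h t / t)"
    by (rule lebesgue_integral_eq_integral)
      (use assms in \<open>auto simp: mellin_integrable_iff set_integrable_def integrable_restrict_space\<close>)
  finally show ?thesis .
qed

text \<open>
  The measure \<open>dt / t\<close> is dilation invariant and \<open>t \<mapsto> t powr w\<close> scales it by \<open>1 / w\<close>. The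
  identity holds for every \<open>h\<close>: the two integrands are integrable or not together, and if not, both
  integrals have the default value \<open>0\<close>.
\<close>

lemma mellin_power_substitution:
  fixes h :: "real \<Rightarrow> real"
  assumes c: "c > 0" and w: "w > 0"
  shows "w * (\<integral>t. h (c * t powr w) \<partial>mellin_measure) = integral\<^sup>L mellin_measure h"
proof -
  let ?g = "\<lambda>t::real. c * t powr w" and ?g' = "\<lambda>t::real. c * (w * t powr (w - 1))"
  let ?T = "\<lambda>t. w * h (?g t)"
  have inj: "inj_on ?g {0<..}"
    by (rule inj_on_inverseI[where g = "\<lambda>u. (u / c) powr (1 / w)"])
      (use c w in \<open>auto simp: powr_powr\<close>)
  have img: "?g ` {0<..} = {0<..}"
  proof (intro equalityI subsetI)
    fix y :: real assume y: "y \<in> {0<..}"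
    have "y = ?g ((y / c) powr (1 / w))" using y c w by (simp add: powr_powr)
    moreover have "(y / c) powr (1 / w) \<in> {0<..}" using y c by simp
    ultimately show "y \<in> ?g ` {0<..}" by blast
  qed (use c in auto)
  have der: "(?g has_field_derivative ?g' t) (at t within {0<..})" if "t \<in> {0<..}" for t
    using that by (auto intro!: derivative_eq_intros)
  have eq: "\<bar>?g' t\<bar> * (h (?g t) / ?g t) = ?T t / t" if "t \<in> {0<..}" for t
    using that c w by (simp add: powr_diff field_simps)
  have abs_int: "(\<lambda>t. \<bar>?g' t\<bar> * (h (?g t) / ?g t)) absolutely_integrable_on {0<..} \<longleftrightarrow>
      (\<lambda>t. ?T t / t) absolutely_integrable_on {0<..}"
    by (rule set_integrable_cong[OF refl refl eq])
  have int_eq: "integral {0<..} (\<lambda>t. \<bar>?g' t\<bar> * (h (?g t) / ?g t)) = integral {0<..} (\<lambda>t. ?T t / t)"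
    by (rule Henstock_Kurzweil_Integration.integral_cong[OF eq])
  have leb: "{0::real<..} \<in> sets lebesgue" by simp
  have subst: "(\<lambda>t. ?T t / t) absolutely_integrable_on {0<..} \<and> integral {0<..} (\<lambda>t. ?T t / t) = b
      \<longleftrightarrow> (\<lambda>u. h u / u) absolutely_integrable_on {0<..} \<and> integral {0<..} (\<lambda>u. h u / u) = b" for b
    using has_absolute_integral_change_of_variables_1'
        [where f = "\<lambda>u. h u / u" and S = "{0<..}" and b = b, OF leb der inj]
    unfolding img abs_int int_eq .
  then have int: "integrable mellin_measure ?T \<longleftrightarrow> integrable mellin_measure h"
    unfolding mellin_integrable_iff by blast
  have "integral\<^sup>L mellin_measure ?T = integral\<^sup>L mellin_measure h"
  proof (cases "integrable mellin_measure h")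
    case True
    have "integral {0<..} (\<lambda>t. ?T t / t) = integral {0<..} (\<lambda>u. h u / u)"
      using subst[of "integral {0<..} (\<lambda>u. h u / u)"] True[unfolded mellin_integrable_iff] by blast
    then show ?thesis
      unfolding mellin_integral_eq[OF True] mellin_integral_eq[OF int[THEN iffD2, OF True]] .
  next
    case False
    then have "\<not> integrable mellin_measure ?T" using int by blast
    then show ?thesis
      using False by (metis not_integrable_integral_eq)
  qed
  then show ?thesis by (simp only: integral_mult_right_zero)
qed

section \<open>Taylor expansion with Mellin derivatives\<close>

lemma mellin_deriv_funpow_diff:
  assumes f: "\<And>i s. i < j \<Longrightarrow> s > 0 \<Longrightarrow> (mellin_deriv ^^ i) f field_differentiable (at s)"
    and g: "\<And>i s. i < j \<Longrightarrow> s > 0 \<Longrightarrow> (mellin_deriv ^^ i) g field_differentiable (at s)"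
    and "s > 0"
  shows "(mellin_deriv ^^ j) (\<lambda>t. f t - g t) s = (mellin_deriv ^^ j) f s - (mellin_deriv ^^ j) g s"
  using assms
proof (induction j arbitrary: s)
  case (Suc j)
  have "\<forall>\<^sub>F t in nhds s. (mellin_deriv ^^ j) (\<lambda>t. f t - g t) t
      = (mellin_deriv ^^ j) f t - (mellin_deriv ^^ j) g t"
    using eventually_nhds_in_open[of "{0<..}" s] Suc.prems(3)
    by (auto elim!: eventually_mono intro!: Suc.IH Suc.prems)
  then have "deriv ((mellin_deriv ^^ j) (\<lambda>t. f t - g t)) s
      = deriv (\<lambda>t. (mellin_deriv ^^ j) f t - (mellin_deriv ^^ j) g t) s"
    by (rule deriv_cong_ev) simp
  also have "\<dots> = deriv ((mellin_deriv ^^ j) f) s - deriv ((mellin_deriv ^^ j) g) s"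
    by (intro deriv_diff Suc.prems) auto
  finally show ?case by (simp add: mellin_deriv_def[of _ s] right_diff_distrib)
qed simp

text \<open>
  The chain rule gives \<open>(d/ds) h (exp s) = (mellin_deriv h) (exp s)\<close>, so this is the Lagrange form
  of Taylor's theorem for \<open>s \<mapsto> h (exp s)\<close> at \<open>s = ln t\<close> around \<open>ln x\<close>.
\<close>

lemma mellin_taylor:
  fixes h :: "real \<Rightarrow> real"
  assumes h: "\<And>i s. i < n \<Longrightarrow> s > 0 \<Longrightarrow> (mellin_deriv ^^ i) h field_differentiable (at s)"
    and n: "n > 0" and x: "x > 0" and t: "t > 0"
  obtains \<xi> where "\<xi> > 0"
    "h t = (\<Sum>j<n. (mellin_deriv ^^ j) h x / fact j * (ln t - ln x) ^ j)
         + (mellin_deriv ^^ n) h \<xi> / fact n * (ln t - ln x) ^ n"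
proof (cases "t = x")
  case True
  have "(\<Sum>j<n. (mellin_deriv ^^ j) h x / fact j * (ln t - ln x) ^ j) = h x"
  proof -
    obtain m where "n = Suc m" using n by (cases n) auto
    then show ?thesis using True by (simp only: sum.lessThan_Suc_shift) simp
  qed
  then show ?thesis using that[OF x] True n by simp
next
  case False
  let ?D = "\<lambda>j s. (mellin_deriv ^^ j) h (exp s)"
  have D: "DERIV (?D j) s :> ?D (Suc j) s" if "j < n" for j s
  proof -
    have "DERIV ((mellin_deriv ^^ j) h) (exp s) :> deriv ((mellin_deriv ^^ j) h) (exp s)"
      using h[OF that, of "exp s"] by (simp add: field_differentiable_derivI)
    from DERIV_chain2[OF this DERIV_exp] show ?thesis
      by (simp add: mellin_deriv_def mult.commute)
  qed
  obtain s where "h (exp (ln t)) = (\<Sum>j<n. ?D j (ln x) / fact j * (ln t - ln x) ^ j)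
      + ?D n s / fact n * (ln t - ln x) ^ n"
    using Taylor[of n ?D "\<lambda>s. h (exp s)" "min (ln x) (ln t)" "max (ln x) (ln t)" "ln x" "ln t"]
      n D False x t by auto
  then show ?thesis using that[of "exp s"] x t by simp
qed

text \<open>
  The two parts of \<open>f = (f - g) + g\<close> are expanded to different orders. For \<open>f - g\<close> only
  derivatives up to order \<open>r\<close> are available, so its Lagrange remainder of order \<open>r\<close> must be compared with
  the \<open>r\<close>-th Taylor term itself; this difference of two values of the \<open>r\<close>-th derivative costs the
  factor \<open>2\<close>. For \<open>g\<close> the remainder has order \<open>r + 1\<close> and no such loss occurs.
\<close>

lemma mellin_taylor_smoothing_bound:
  fixes f g :: "real \<Rightarrow> real"
  assumes f: "f \<in> mellin_C r" and g: "g \<in> mellin_C (Suc r)" and r: "r > 0"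
    and x: "x > 0" and t: "t > 0"
    and \<alpha>: "\<And>s. s > 0 \<Longrightarrow> \<bar>(mellin_deriv ^^ r) (\<lambda>t. f t - g t) s\<bar> \<le> \<alpha>"
    and \<beta>: "\<And>s. s > 0 \<Longrightarrow> \<bar>(mellin_deriv ^^ Suc r) g s\<bar> \<le> \<beta>"
  shows "\<bar>f t - (\<Sum>j\<le>r. (mellin_deriv ^^ j) f x / fact j * (ln t - ln x) ^ j)\<bar>
      \<le> 2 * \<alpha> / fact r * \<bar>ln t - ln x\<bar> ^ r + \<beta> / fact (Suc r) * \<bar>ln t - ln x\<bar> ^ Suc r"
proof -
  let ?h = "\<lambda>t. f t - g t" and ?L = "ln t - ln x" and ?D = "\<lambda>j. mellin_deriv ^^ j"
  have df: "?D i f field_differentiable (at s)" if "i < r" "s > 0" for i s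
    using f that unfolding mellin_C_def by blast
  have dg: "?D i g field_differentiable (at s)" if "i < Suc r" "s > 0" for i s
    using g that unfolding mellin_C_def by blast
  have h: "?D j ?h s = ?D j f s - ?D j g s" if "j \<le> r" "s > 0" for j s
    using that by (intro mellin_deriv_funpow_diff df dg) auto
  have dh: "?D i ?h field_differentiable (at s)" if "i < r" "s > 0" for i s
  proof -
    have "(\<lambda>t. ?D i f t - ?D i g t) field_differentiable (at s)"
      using that by (intro field_differentiable_diff df dg) auto
    then obtain D where "((\<lambda>t. ?D i f t - ?D i g t) has_field_derivative D) (at s)"
      by (auto simp: field_differentiable_def)
    then have "(?D i ?h has_field_derivative D) (at s)"
      by (rule has_field_derivative_transform_within_open[of _ _ _ "{0<..}"]) (use that h in auto)
    then show ?thesis by (auto simp: field_differentiable_def)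
  qed
  obtain \<xi> where \<xi>: "\<xi> > 0" and th: "?h t = (\<Sum>j<r. ?D j ?h x / fact j * ?L ^ j) + ?D r ?h \<xi> / fact r * ?L ^ r"
    using mellin_taylor[of r ?h, OF dh r x t] by blast
  obtain \<zeta> where \<zeta>: "\<zeta> > 0" and tg: "g t = (\<Sum>j<Suc r. ?D j g x / fact j * ?L ^ j)
      + ?D (Suc r) g \<zeta> / fact (Suc r) * ?L ^ Suc r"
    using mellin_taylor[of "Suc r" g, OF dg _ x t] by blast
  have poly: "(\<Sum>j\<le>r. ?D j f x / fact j * ?L ^ j) =
      (\<Sum>j<r. ?D j ?h x / fact j * ?L ^ j) + ?D r ?h x / fact r * ?L ^ r
      + (\<Sum>j<Suc r. ?D j g x / fact j * ?L ^ j)"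
  proof -
    have "(\<Sum>j\<le>r. ?D j f x / fact j * ?L ^ j) =
        (\<Sum>j\<le>r. ?D j ?h x / fact j * ?L ^ j + ?D j g x / fact j * ?L ^ j)"
      using x by (intro sum.cong) (auto simp: h diff_divide_distrib left_diff_distrib simp del: funpow.simps)
    also have "\<dots> = (\<Sum>j\<le>r. ?D j ?h x / fact j * ?L ^ j) + (\<Sum>j\<le>r. ?D j g x / fact j * ?L ^ j)"
      by (rule sum.distrib)
    finally show ?thesis by (simp only: lessThan_Suc_atMost[symmetric] sum.lessThan_Suc)
  qed
  have eq: "f t - (\<Sum>j\<le>r. ?D j f x / fact j * ?L ^ j)
      = (?D r ?h \<xi> - ?D r ?h x) / fact r * ?L ^ r + ?D (Suc r) g \<zeta> / fact (Suc r) * ?L ^ Suc r"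
    unfolding poly using th tg by (simp only: diff_divide_distrib left_diff_distrib)
  have "\<bar>f t - (\<Sum>j\<le>r. ?D j f x / fact j * ?L ^ j)\<bar> \<le> \<bar>(?D r ?h \<xi> - ?D r ?h x) / fact r * ?L ^ r\<bar> + \<bar>?D (Suc r) g \<zeta> / fact (Suc r) * ?L ^ Suc r\<bar>"
    unfolding eq by (rule abs_triangle_ineq)
  also have "\<dots> \<le> 2 * \<alpha> / fact r * \<bar>?L\<bar> ^ r + \<beta> / fact (Suc r) * \<bar>?L\<bar> ^ Suc r"
  proof (rule add_mono)
    have "\<bar>?D r ?h \<xi> - ?D r ?h x\<bar> \<le> 2 * \<alpha>"
      using \<alpha>[OF \<xi>] \<alpha>[OF x] by linarith
    then show "\<bar>(?D r ?h \<xi> - ?D r ?h x) / fact r * ?L ^ r\<bar> \<le> 2 * \<alpha> / fact r * \<bar>?L\<bar> ^ r"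
      unfolding abs_mult power_abs abs_divide
      by (intro mult_right_mono) (simp_all add: divide_right_mono del: funpow.simps fact_Suc)
    show "\<bar>?D (Suc r) g \<zeta> / fact (Suc r) * ?L ^ Suc r\<bar> \<le> \<beta> / fact (Suc r) * \<bar>?L\<bar> ^ Suc r"
      using \<beta>[OF \<zeta>] unfolding abs_mult power_abs abs_divide
      by (intro mult_right_mono) (simp_all add: divide_right_mono del: funpow.simps fact_Suc)
  qed
  finally show ?thesis .
qed

section \<open>Power inequalities\<close>

text \<open>
  The sharp constant \<open>2 ^ n\<close> comes from Chebyshev's inequality
  \<open>(a ^ n + b ^ n) * (a + b) \<le> 2 * (a ^ (n + 1) + b ^ (n + 1))\<close> for nonnegative \<open>a\<close> and \<open>b\<close>, which
  contributes one factor \<open>2\<close> in each induction step.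
\<close>

lemma abs_add_power_le:
  fixes a b :: real
  shows "\<bar>a + b\<bar> ^ Suc n \<le> 2 ^ n * (\<bar>a\<bar> ^ Suc n + \<bar>b\<bar> ^ Suc n)"
proof (induction n)
  case (Suc n)
  let ?A = "\<bar>a\<bar>" and ?B = "\<bar>b\<bar>"
  have "0 \<le> (?A ^ Suc n - ?B ^ Suc n) * (?A - ?B)"
    by (cases "?A \<le> ?B") (auto intro!: mult_nonneg_nonneg mult_nonpos_nonpos power_mono simp del: power_Suc)
  then have cheb: "(?A ^ Suc n + ?B ^ Suc n) * (?A + ?B) \<le> 2 * (?A ^ Suc (Suc n) + ?B ^ Suc (Suc n))"
    by (simp add: algebra_simps)
  have "\<bar>a + b\<bar> ^ Suc (Suc n) \<le> (2 ^ n * (?A ^ Suc n + ?B ^ Suc n)) * (?A + ?B)"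
    unfolding power_Suc2[of "\<bar>a + b\<bar>" "Suc n"] using Suc by (intro mult_mono) auto
  also have "\<dots> = 2 ^ n * ((?A ^ Suc n + ?B ^ Suc n) * (?A + ?B))" by simp
  also have "\<dots> \<le> 2 ^ n * (2 * (?A ^ Suc (Suc n) + ?B ^ Suc (Suc n)))"
    by (intro mult_left_mono cheb) auto
  finally show ?case by (simp add: algebra_simps)
qed simp

lemma power_le_one_plus_power:
  fixes y :: real
  assumes "y \<ge> 0" "m \<le> n"
  shows "y ^ m \<le> 1 + y ^ n"
proof (cases "y \<le> 1")
  case True
  then show ?thesis using assms power_le_one[of y m] zero_le_power[of y n] by linarith
next
  case False
  then show ?thesis using assms power_increasing[of m n y] by linarith
qed

section \<open>Averaging a polynomial approximation\<close>

text \<open>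
  The averaging argument, free of its analytic origin: \<open>E k\<close> is approximated by a polynomial in
  \<open>l + d k\<close>, with an error in which \<open>l\<close> and \<open>d k\<close> are already separated. Averaging the polynomial
  with \<open>phi\<close> and \<open>a\<close> factors into moments by the binomial theorem. Averaging the error bound
  factors as well, each summand into an absolute moment of \<open>phi\<close> times one of \<open>a\<close>. The same bound
  makes the error integrable and its integrals summable, so the average of \<open>E\<close> splits.
\<close>

lemma infsum_power_moment_expansion_error:
  fixes M :: "'b measure" and phi l :: "'b \<Rightarrow> real" and a d :: "'i \<Rightarrow> real"
    and E :: "'i \<Rightarrow> 'b \<Rightarrow> real" and c :: "nat \<Rightarrow> real"
  defines "S \<equiv> \<lambda>\<nu>. \<Sum>\<^sub>\<infinity>k. \<bar>a k\<bar> * \<bar>d k\<bar> ^ \<nu>"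
    and "I \<equiv> \<lambda>\<nu>. \<integral>u. \<bar>phi u\<bar> * \<bar>l u\<bar> ^ \<nu> \<partial>M"
  assumes E: "\<And>k. E k \<in> borel_measurable M"
    and a: "\<And>\<nu>. \<nu> \<le> Suc r \<Longrightarrow> (\<lambda>k. \<bar>a k\<bar> * \<bar>d k\<bar> ^ \<nu>) summable_on UNIV"
    and phi: "\<And>\<nu>. \<nu> \<le> Suc r \<Longrightarrow> integrable M (\<lambda>u. phi u * l u ^ \<nu>)"
    and err: "\<And>k u. u \<in> space M \<Longrightarrow> \<bar>E k u - (\<Sum>j\<le>r. c j * (l u + d k) ^ j)\<bar>
        \<le> P * (\<bar>l u\<bar> ^ r + \<bar>d k\<bar> ^ r) + Q * (\<bar>l u\<bar> ^ Suc r + \<bar>d k\<bar> ^ Suc r)"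
  shows "\<bar>(\<Sum>\<^sub>\<infinity>k. a k * (\<integral>u. phi u * E k u \<partial>M))
       - (\<Sum>j\<le>r. c j * (\<Sum>\<eta>\<le>j. of_nat (j choose \<eta>) * (\<integral>u. phi u * l u ^ (j - \<eta>) \<partial>M)
            * (\<Sum>\<^sub>\<infinity>k. a k * d k ^ \<eta>)))\<bar>
     \<le> P * (S 0 * I r + S r * I 0) + Q * (S 0 * I (Suc r) + S (Suc r) * I 0)"
proof -
  define m where "m \<nu> = (\<integral>u. phi u * l u ^ \<nu> \<partial>M)" for \<nu>
  define T where "T k u = (\<Sum>j\<le>r. c j * (l u + d k) ^ j)" for k u
  define J where "J k = (\<Sum>j\<le>r. c j * (\<Sum>\<eta>\<le>j. of_nat (j choose \<eta>) * m (j - \<eta>) * d k ^ \<eta>))" for k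
  define b where "b k u = P * (\<bar>phi u\<bar> * \<bar>l u\<bar> ^ r + \<bar>d k\<bar> ^ r * (\<bar>phi u\<bar> * \<bar>l u\<bar> ^ 0))
      + Q * (\<bar>phi u\<bar> * \<bar>l u\<bar> ^ Suc r + \<bar>d k\<bar> ^ Suc r * (\<bar>phi u\<bar> * \<bar>l u\<bar> ^ 0))" for k u
  define \<beta> where "\<beta> k = P * (I r + \<bar>d k\<bar> ^ r * I 0) + Q * (I (Suc r) + \<bar>d k\<bar> ^ Suc r * I 0)" for k

  have abs_phi: "integrable M (\<lambda>u. \<bar>phi u\<bar> * \<bar>l u\<bar> ^ \<nu>)" if "\<nu> \<le> Suc r" for \<nu>
    using integrable_abs[OF phi[OF that]] by (simp add: abs_mult power_abs)
  have phi_meas: "phi \<in> borel_measurable M"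
    using borel_measurable_integrable[OF phi[of 0]] by simp

  have T_int: "integrable M (\<lambda>u. phi u * T k u)" and T_eq: "(\<integral>u. phi u * T k u \<partial>M) = J k" for k
  proof -
    have "phi u * T k u = (\<Sum>j\<le>r. c j * (\<Sum>\<eta>\<le>j. of_nat (j choose \<eta>) * (phi u * l u ^ (j - \<eta>)) * d k ^ \<eta>))" for u
      by (simp add: T_def add.commute[of "l u"] binomial_ring sum_distrib_left mult.assoc mult.left_commute)
        (simp add: mult_ac)
    then have *: "(\<lambda>u. phi u * T k u) =
        (\<lambda>u. \<Sum>j\<le>r. c j * (\<Sum>\<eta>\<le>j. of_nat (j choose \<eta>) * (phi u * l u ^ (j - \<eta>)) * d k ^ \<eta>))"
      by blast
    have "has_bochner_integral M (\<lambda>u. phi u * T k u) (J k)"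
      unfolding * J_def m_def
      by (intro has_bochner_integral_sum has_bochner_integral_mult_right
            has_bochner_integral_mult_left has_bochner_integral_integrable phi) auto
    then show "integrable M (\<lambda>u. phi u * T k u)" "(\<integral>u. phi u * T k u \<partial>M) = J k"
      by (auto simp: has_bochner_integral_iff)
  qed

  have b_int: "has_bochner_integral M (b k) (\<beta> k)" for k
    unfolding b_def \<beta>_def I_def
    by (intro has_bochner_integral_add has_bochner_integral_mult_right
          has_bochner_integral_integrable abs_phi) auto
  have b_integrable: "integrable M (b k)" for k
    using b_int by (rule integrable.intros)
  have le_b: "\<bar>phi u * (E k u - T k u)\<bar> \<le> b k u" if "u \<in> space M" for k u
  proof -
    have "\<bar>phi u * (E k u - T k u)\<bar> \<le> \<bar>phi u\<bar> *
        (P * (\<bar>l u\<bar> ^ r + \<bar>d k\<bar> ^ r) + Q * (\<bar>l u\<bar> ^ Suc r + \<bar>d k\<bar> ^ Suc r))"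
      unfolding abs_mult T_def by (rule mult_left_mono[OF err[OF that] abs_ge_zero])
    then show ?thesis by (simp add: b_def algebra_simps)
  qed
  have T_meas: "(\<lambda>u. phi u * T k u) \<in> borel_measurable M" for k
    using T_int by (rule borel_measurable_integrable)
  have R_int: "integrable M (\<lambda>u. phi u * (E k u - T k u))" for k
  proof (rule Bochner_Integration.integrable_bound[of _ "b k"])
    show "integrable M (b k)" by (rule b_integrable)
    have "(\<lambda>u. phi u * E k u - phi u * T k u) \<in> borel_measurable M"
      by (intro borel_measurable_diff borel_measurable_times phi_meas E T_meas)
    then show "(\<lambda>u. phi u * (E k u - T k u)) \<in> borel_measurable M"
      by (simp add: right_diff_distrib)
    show "AE u in M. norm (phi u * (E k u - T k u)) \<le> norm (b k u)"
      by (intro AE_I2) (metis le_b abs_ge_self order_trans real_norm_def)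
  qed
  have R_le: "\<bar>\<integral>u. phi u * (E k u - T k u) \<partial>M\<bar> \<le> \<beta> k" for k
  proof -
    have "\<bar>\<integral>u. phi u * (E k u - T k u) \<partial>M\<bar> \<le> (\<integral>u. \<bar>phi u * (E k u - T k u)\<bar> \<partial>M)"
      by (rule integral_abs_bound)
    also have "\<dots> \<le> (\<integral>u. b k u \<partial>M)"
      by (rule integral_mono) (auto intro: integrable_abs R_int b_integrable le_b)
    also have "\<dots> = \<beta> k" using b_int by (rule has_bochner_integral_integral_eq)
    finally show ?thesis .
  qed
  have split: "(\<integral>u. phi u * E k u \<partial>M) = J k + (\<integral>u. phi u * (E k u - T k u) \<partial>M)" for k
  proof -
    have "J k + (\<integral>u. phi u * (E k u - T k u) \<partial>M) = (\<integral>u. phi u * T k u + phi u * (E k u - T k u) \<partial>M)"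
      unfolding T_eq[symmetric] by (rule Bochner_Integration.integral_add[symmetric, OF T_int R_int])
    then show ?thesis by (simp add: algebra_simps)
  qed

  have pow: "(\<lambda>k. a k * d k ^ \<eta>) summable_on UNIV" if "\<eta> \<le> Suc r" for \<eta>
    by (rule abs_summable_summable[of "\<lambda>k. a k * d k ^ \<eta>"]) (use a[OF that] in \<open>simp add: abs_mult power_abs\<close>)
  have J_sum: "((\<lambda>k. a k * J k) has_sum (\<Sum>j\<le>r. c j * (\<Sum>\<eta>\<le>j. of_nat (j choose \<eta>) * m (j - \<eta>)
      * (\<Sum>\<^sub>\<infinity>k. a k * d k ^ \<eta>)))) UNIV"
  proof -
    have "a k * J k = (\<Sum>j\<le>r. c j * (\<Sum>\<eta>\<le>j. of_nat (j choose \<eta>) * m (j - \<eta>) * (a k * d k ^ \<eta>)))" for k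
      by (simp add: J_def sum_distrib_left mult_ac)
    then have *: "(\<lambda>k. a k * J k) = (\<lambda>k. \<Sum>j\<le>r. c j * (\<Sum>\<eta>\<le>j. of_nat (j choose \<eta>) * m (j - \<eta>) * (a k * d k ^ \<eta>)))"
      by blast
    have fin: "((\<lambda>k. \<Sum>j\<in>A. F j k) has_sum (\<Sum>j\<in>A. s j)) UNIV"
      if "finite A" "\<And>j. j \<in> A \<Longrightarrow> (F j has_sum s j) UNIV"
      for A :: "nat set" and F :: "nat \<Rightarrow> 'i \<Rightarrow> real" and s
      using that by (induction A rule: finite_induct) (auto intro!: has_sum_add)
    show ?thesis
      unfolding * by (intro fin has_sum_cmult_right has_sum_infsum pow) auto
  qed
  have \<beta>_sum: "((\<lambda>k. \<bar>a k\<bar> * \<beta> k) has_sum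
      (P * (S 0 * I r + S r * I 0) + Q * (S 0 * I (Suc r) + S (Suc r) * I 0))) UNIV"
  proof -
    have "(\<lambda>k. \<bar>a k\<bar> * \<beta> k) = (\<lambda>k.
        P * (\<bar>a k\<bar> * \<bar>d k\<bar> ^ 0 * I r + \<bar>a k\<bar> * \<bar>d k\<bar> ^ r * I 0)
        + Q * (\<bar>a k\<bar> * \<bar>d k\<bar> ^ 0 * I (Suc r) + \<bar>a k\<bar> * \<bar>d k\<bar> ^ Suc r * I 0))"
      by (simp add: \<beta>_def algebra_simps)
    then show ?thesis
      unfolding S_def
      by (simp only:) (intro has_sum_add has_sum_cmult_right has_sum_cmult_left has_sum_infsum a; simp)
  qed
  \<comment> \<open>the contribution of the approximation error, dominated by the summable \<open>\<bar>a k\<bar> * \<beta> k\<close>\<close>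
  let ?R = "\<lambda>k. a k * (\<integral>u. phi u * (E k u - T k u) \<partial>M)"
  have R_bound: "norm (?R k) \<le> \<bar>a k\<bar> * \<beta> k" for k
    using R_le by (simp add: abs_mult mult_left_mono)
  have R_abs: "(\<lambda>k. norm (?R k)) summable_on UNIV"
    by (rule summable_on_comparison_test[OF has_sum_imp_summable[OF \<beta>_sum]]) (use R_bound in auto)
  have "(\<Sum>\<^sub>\<infinity>k. a k * (\<integral>u. phi u * E k u \<partial>M)) = (\<Sum>\<^sub>\<infinity>k. a k * J k + ?R k)"
    by (simp add: split distrib_left)
  also have "\<dots> = (\<Sum>\<^sub>\<infinity>k. a k * J k) + (\<Sum>\<^sub>\<infinity>k. ?R k)"
    by (rule infsum_add) (use J_sum R_abs in \<open>auto intro: has_sum_imp_summable abs_summable_summable\<close>)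
  finally have "(\<Sum>\<^sub>\<infinity>k. a k * (\<integral>u. phi u * E k u \<partial>M)) - (\<Sum>\<^sub>\<infinity>k. a k * J k) = (\<Sum>\<^sub>\<infinity>k. ?R k)"
    by simp
  moreover have "\<bar>\<Sum>\<^sub>\<infinity>k. ?R k\<bar> \<le> P * (S 0 * I r + S r * I 0) + Q * (S 0 * I (Suc r) + S (Suc r) * I 0)"
  proof -
    have "norm (\<Sum>\<^sub>\<infinity>k. ?R k) \<le> (\<Sum>\<^sub>\<infinity>k. norm (?R k))"
      by (rule norm_infsum_bound[OF R_abs])
    also have "\<dots> \<le> (\<Sum>\<^sub>\<infinity>k. \<bar>a k\<bar> * \<beta> k)"
      by (rule infsum_mono[OF R_abs has_sum_imp_summable[OF \<beta>_sum] R_bound])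
    finally show ?thesis using infsumI[OF \<beta>_sum] by simp
  qed
  ultimately show ?thesis
    unfolding infsumI[OF J_sum] m_def by simp
qed

section \<open>Moments of the kernels\<close>

lemma ennreal_summable_on:
  fixes f :: "'a \<Rightarrow> ennreal"
  shows "f summable_on A"
  by (simp add: nonneg_summable_on_complete)

text \<open>
  Terms with \<open>\<bar>k - ln u\<bar> \<ge> 1\<close> only grow when multiplied by \<open>\<bar>k - ln u\<bar> ^ r\<close>, so the moment of
  order \<open>r\<close> controls them. At most two indices remain, the floor of \<open>ln u\<close> and its successor, and for
  them \<open>exp (- k) * u\<close> lies in the compact interval from \<open>exp (- 1)\<close> to \<open>exp 1\<close>, where \<open>chi\<close> is
  bounded independently of \<open>u\<close>.
\<close>

lemma abs_moment_zero_finite: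
  assumes chi: "continuous_on {0<..} chi" and r: "abs_moment r chi < \<infinity>"
  shows "abs_moment 0 chi < \<infinity>"
proof -
  have "compact (chi ` {exp (- 1)..exp 1})"
    by (intro compact_continuous_image continuous_on_subset[OF chi]) (auto intro: less_le_trans[OF exp_gt_zero])
  then obtain C where C: "C \<ge> 0" "\<And>y. exp (- 1) \<le> y \<Longrightarrow> y \<le> exp 1 \<Longrightarrow> \<bar>chi y\<bar> \<le> C"
    using compact_imp_bounded[of "chi ` {exp (- 1)..exp 1}"] unfolding bounded_iff
    by (metis (no_types, opaque_lifting) abs_ge_zero atLeastAtMost_iff image_eqI norm_conv_dist order_trans
        real_norm_def order_refl)
  have "(\<Sum>\<^sub>\<infinity>k::int. ennreal (\<bar>chi (exp (- of_int k) * u)\<bar> * \<bar>of_int k - ln u\<bar> ^ 0))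
      \<le> abs_moment r chi + ennreal (2 * C)" if u: "u > 0" for u
  proof -
    let ?a = "\<lambda>k::int. \<bar>chi (exp (- of_int k) * u)\<bar>" and ?N = "{\<lfloor>ln u\<rfloor>, \<lfloor>ln u\<rfloor> + 1}"
    have *: "ennreal (?a k * \<bar>of_int k - ln u\<bar> ^ 0)
        \<le> ennreal (?a k * \<bar>of_int k - ln u\<bar> ^ r) + (if k \<in> ?N then ennreal C else 0)" for k
    proof (cases "\<bar>of_int k - ln u\<bar> < 1")
      case True
      then have "k \<in> ?N" by simp linarith
      moreover have "?a k \<le> C"
      proof -
        have "exp (- of_int k) * u = exp (ln u - of_int k)"
          using u by (simp add: exp_diff exp_minus field_simps)
        then show ?thesis using True by (intro C) auto
      qed
      ultimately show ?thesis
        by (auto intro!: add_increasing ennreal_leI)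
    next
      case False
      then have "?a k * 1 \<le> ?a k * \<bar>of_int k - ln u\<bar> ^ r"
        by (intro mult_left_mono one_le_power) auto
      then show ?thesis by (intro add_increasing2) (auto intro!: ennreal_leI)
    qed
    have "(\<Sum>\<^sub>\<infinity>k. ennreal (?a k * \<bar>of_int k - ln u\<bar> ^ 0))
        \<le> (\<Sum>\<^sub>\<infinity>k. ennreal (?a k * \<bar>of_int k - ln u\<bar> ^ r) + (if k \<in> ?N then ennreal C else 0))"
      by (rule infsum_mono[OF ennreal_summable_on ennreal_summable_on *])
    also have "\<dots> = (\<Sum>\<^sub>\<infinity>k. ennreal (?a k * \<bar>of_int k - ln u\<bar> ^ r)) + (\<Sum>\<^sub>\<infinity>k. if k \<in> ?N then ennreal C else 0)"
      by (rule infsum_add[OF ennreal_summable_on ennreal_summable_on])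
    also have "(\<Sum>\<^sub>\<infinity>k. if k \<in> ?N then ennreal C else 0) = (\<Sum>\<^sub>\<infinity>k\<in>?N. ennreal C)"
      by (rule infsum_cong_neutral) auto
    also have "\<dots> = ennreal (2 * C)"
      using C(1) by (simp add: ennreal_mult)
    also have "(\<Sum>\<^sub>\<infinity>k. ennreal (?a k * \<bar>of_int k - ln u\<bar> ^ r)) \<le> abs_moment r chi"
      unfolding abs_moment_def using u by (intro SUP_upper) auto
    finally show ?thesis by (simp add: add_right_mono)
  qed
  then have "abs_moment 0 chi \<le> abs_moment r chi + ennreal (2 * C)"
    unfolding abs_moment_def by (intro SUP_least) auto
  then show ?thesis using r by (auto simp: less_top[symmetric] top_unique)
qed

lemma abs_moment_summable:
  assumes fin: "abs_moment \<nu> chi < \<infinity>" and u: "u > 0"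
  shows "(\<lambda>k::int. \<bar>chi (exp (- of_int k) * u)\<bar> * \<bar>of_int k - ln u\<bar> ^ \<nu>) summable_on UNIV" (is "?f summable_on _")
    and "(\<Sum>\<^sub>\<infinity>k::int. \<bar>chi (exp (- of_int k) * u)\<bar> * \<bar>of_int k - ln u\<bar> ^ \<nu>) \<le> enn2real (abs_moment \<nu> chi)"
proof -
  have le: "sum ?f F \<le> enn2real (abs_moment \<nu> chi)" if "finite F" for F
  proof -
    have "ennreal (sum ?f F) = (\<Sum>\<^sub>\<infinity>k\<in>F. ennreal (?f k))"
      using that by (simp add: sum_ennreal)
    also have "\<dots> \<le> (\<Sum>\<^sub>\<infinity>k. ennreal (?f k))"
      by (rule infsum_mono_neutral[OF ennreal_summable_on ennreal_summable_on]) auto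
    also have "\<dots> \<le> abs_moment \<nu> chi"
      unfolding abs_moment_def using u by (intro SUP_upper) auto
    finally have "enn2real (ennreal (sum ?f F)) \<le> enn2real (abs_moment \<nu> chi)"
      using fin by (intro enn2real_mono) auto
    then show ?thesis by (simp add: sum_nonneg)
  qed
  show sm: "?f summable_on UNIV"
    by (rule nonneg_bdd_above_summable_on) (auto intro!: bdd_aboveI2 le)
  show "infsum ?f UNIV \<le> enn2real (abs_moment \<nu> chi)"
    by (rule infsum_le_finite_sums[OF sm]) (use le in auto)
qed

lemma int_abs_moment_integrable:
  assumes phi: "phi \<in> borel_measurable mellin_measure" and fin: "int_abs_moment \<nu> phi < \<infinity>"
  shows "integrable mellin_measure (\<lambda>u. phi u * ln u ^ \<nu>)"
    and "int_abs_moment \<nu> phi = ennreal (\<integral>u. \<bar>phi u\<bar> * \<bar>ln u\<bar> ^ \<nu> \<partial>mellin_measure)"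
proof -
  have "(\<lambda>u. ln u ^ \<nu>) \<in> borel_measurable mellin_measure"
    by (rule continuous_imp_measurable_mellin) (auto intro!: continuous_intros)
  then have "(\<lambda>u. phi u * ln u ^ \<nu>) \<in> borel_measurable mellin_measure"
    using phi by (intro borel_measurable_times)
  then show int: "integrable mellin_measure (\<lambda>u. phi u * ln u ^ \<nu>)"
    using fin by (intro integrableI_bounded) (auto simp: int_abs_moment_def abs_mult power_abs)
  show "int_abs_moment \<nu> phi = ennreal (\<integral>u. \<bar>phi u\<bar> * \<bar>ln u\<bar> ^ \<nu> \<partial>mellin_measure)"
    using nn_integral_eq_integral[OF integrable_abs[OF int]]
    by (simp add: int_abs_moment_def abs_mult power_abs)
qed

text \<open>
  A vanishing absolute moment forces \<open>phi u = 0\<close> almost everywhere off the zero set of \<open>ln\<close>. That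
  set is the single point \<open>1\<close>, which has measure zero.
\<close>

lemma int_abs_moment_pos:
  assumes phi: "phi \<in> borel_measurable mellin_measure"
    and nz: "(\<integral>u. phi u \<partial>mellin_measure) \<noteq> 0"
  shows "int_abs_moment \<nu> phi \<noteq> 0"
proof
  assume 0: "int_abs_moment \<nu> phi = 0"
  have "(\<lambda>u. ln u ^ \<nu>) \<in> borel_measurable mellin_measure"
    by (rule continuous_imp_measurable_mellin) (auto intro!: continuous_intros)
  then have "(\<lambda>u. \<bar>phi u * ln u ^ \<nu>\<bar>) \<in> borel_measurable mellin_measure"
    using phi by (intro borel_measurable_abs borel_measurable_times)
  then have "(\<lambda>u. ennreal (\<bar>phi u\<bar> * \<bar>ln u\<bar> ^ \<nu>)) \<in> borel_measurable mellin_measure"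
    by (intro measurable_compose[OF _ measurable_ennreal]) (simp add: abs_mult power_abs)
  then have "AE u in mellin_measure. ennreal (\<bar>phi u\<bar> * \<bar>ln u\<bar> ^ \<nu>) = 0"
    using 0 by (simp add: int_abs_moment_def nn_integral_0_iff_AE)
  moreover have "AE u in mellin_measure. u \<noteq> 1"
  proof -
    have "AE u in lebesgue. u \<noteq> (1::real)"
      by (rule AE_completion[OF AE_lborel_singleton])
    then have "AE u in lebesgue_on {0<..}. u \<noteq> (1::real)"
      by (subst AE_restrict_space_iff) auto
    moreover have "(\<lambda>t. ennreal (1 / t)) \<in> borel_measurable (lebesgue_on {0<..})"
      by (intro measurable_compose[OF _ measurable_ennreal] continuous_imp_measurable_on_sets_lebesgue)
        (auto intro!: continuous_intros)
    ultimately show ?thesis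
      unfolding mellin_measure_def by (subst AE_density) auto
  qed
  moreover have "AE u in mellin_measure. u > 0"
    by (rule AE_I2) simp
  ultimately have "AE u in mellin_measure. phi u = 0"
    by eventually_elim auto
  then show False
    using nz integral_eq_zero_AE by blast
qed

section \<open>The error estimate\<close>

text \<open>
  The estimate for a fixed \<open>g\<close>. It combines the Taylor bound at the points
  \<open>t = exp ((ln u + k) / w)\<close>, which satisfy \<open>ln t - ln x = (ln u + d k) / w\<close>, with the averaging
  lemma. Hence each power of \<open>\<bar>ln t - ln x\<bar>\<close> brings the matching power of \<open>w\<close> into the denominator.
\<close>

lemma durrmeyer_taylor_smoothing_bound:
  fixes chi phi f g :: "real \<Rightarrow> real" and r :: nat and w x \<alpha> \<beta> :: real
  defines "Mc \<equiv> \<lambda>\<nu>. enn2real (abs_moment \<nu> chi)"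
    and "Mp \<equiv> \<lambda>\<nu>. enn2real (int_abs_moment \<nu> phi)"
  assumes phi: "phi \<in> borel_measurable mellin_measure"
    and chi_fin: "abs_moment 0 chi < \<infinity>" "abs_moment (Suc r) chi < \<infinity>"
    and phi_fin: "int_abs_moment 0 phi < \<infinity>" "int_abs_moment (Suc r) phi < \<infinity>"
    and chi_r: "abs_moment r chi < \<infinity>" and phi_r: "int_abs_moment r phi < \<infinity>"
    and r: "r > 0" and f: "f \<in> mellin_C r" and g: "g \<in> mellin_C (Suc r)"
    and x: "x > 0" and w: "w > 0"
    and \<alpha>: "\<And>s. s > 0 \<Longrightarrow> \<bar>(mellin_deriv ^^ r) (\<lambda>t. f t - g t) s\<bar> \<le> \<alpha>"
    and \<beta>: "\<And>s. s > 0 \<Longrightarrow> \<bar>(mellin_deriv ^^ Suc r) g s\<bar> \<le> \<beta>"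
  shows "\<bar>durrmeyer_sampling chi phi w f x
      - (\<Sum>j\<le>r. (mellin_deriv ^^ j) f x / (fact j * w ^ j) *
          (\<Sum>\<eta>\<le>j. of_nat (j choose \<eta>) * int_moment (j - \<eta>) phi * moment \<eta> chi (x powr w)))\<bar>
    \<le> 2 ^ r * \<alpha> / (fact r * w ^ r) * (Mc 0 * Mp r + Mc r * Mp 0)
      + 2 ^ r * \<beta> / (fact (Suc r) * w ^ Suc r) * (Mc 0 * Mp (Suc r) + Mc (Suc r) * Mp 0)"
proof -
  define u0 where "u0 = x powr w"
  define a where "a k = chi (exp (- of_int k) * u0)" for k :: int
  define d where "d k = of_int k - ln u0" for k :: int
  define E where "E k u = f (exp ((ln u + of_int k) / w))" for k :: int and u
  define c where "c j = (mellin_deriv ^^ j) f x / (fact j * w ^ j)" for j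
  define P where "P = 2 ^ r * \<alpha> / (fact r * w ^ r)"
  define Q where "Q = 2 ^ r * \<beta> / (fact (Suc r) * w ^ Suc r)"
  have u0: "u0 > 0" and ln_u0: "ln u0 = w * ln x"
    using x by (simp_all add: u0_def ln_powr)
  have \<alpha>0: "\<alpha> \<ge> 0" and \<beta>0: "\<beta> \<ge> 0"
    using \<alpha>[OF x] \<beta>[OF x] abs_ge_zero order_trans by blast+
  have PQ: "P \<ge> 0" "Q \<ge> 0"
    using \<alpha>0 \<beta>0 w by (simp_all add: P_def Q_def del: power_Suc fact_Suc)

  have D: "durrmeyer_sampling chi phi w f x = (\<Sum>\<^sub>\<infinity>k. a k * (\<integral>u. phi u * E k u \<partial>mellin_measure))"
  proof -
    have "w * (\<integral>t. phi (exp (- of_int k) * t powr w) * f t \<partial>mellin_measure)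
        = (\<integral>u. phi u * E k u \<partial>mellin_measure)" for k :: int
    proof -
      have "E k (exp (- of_int k) * t powr w) = f t" if "t > 0" for t
        using that w by (simp add: E_def ln_mult ln_powr)
      then have "(\<integral>t. phi (exp (- of_int k) * t powr w) * f t \<partial>mellin_measure)
          = (\<integral>t. phi (exp (- of_int k) * t powr w) * E k (exp (- of_int k) * t powr w) \<partial>mellin_measure)"
        by (intro Bochner_Integration.integral_cong) auto
      then show ?thesis
        using mellin_power_substitution[of "exp (- of_int k)" w "\<lambda>u. phi u * E k u"] w by simp
    qed
    then show ?thesis
      by (simp add: durrmeyer_sampling_def a_def u0_def)
  qed

  have chi_sum: "(\<lambda>k. \<bar>a k\<bar> * \<bar>d k\<bar> ^ \<nu>) summable_on UNIV" if "\<nu> \<le> Suc r" for \<nu>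
  proof (rule summable_on_comparison_test)
    show "(\<lambda>k. \<bar>a k\<bar> * \<bar>d k\<bar> ^ 0 + \<bar>a k\<bar> * \<bar>d k\<bar> ^ Suc r) summable_on UNIV"
      unfolding a_def d_def by (intro summable_on_add abs_moment_summable chi_fin u0)
    fix k :: int
    show "\<bar>a k\<bar> * \<bar>d k\<bar> ^ \<nu> \<le> \<bar>a k\<bar> * \<bar>d k\<bar> ^ 0 + \<bar>a k\<bar> * \<bar>d k\<bar> ^ Suc r"
      using mult_left_mono[OF power_le_one_plus_power[OF abs_ge_zero that], of "\<bar>a k\<bar>" "d k"]
      by (simp add: distrib_left)
  qed simp
  have phi_int: "integrable mellin_measure (\<lambda>u. phi u * ln u ^ \<nu>)" if "\<nu> \<le> Suc r" for \<nu>
  proof (rule int_abs_moment_integrable[OF phi])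
    have "int_abs_moment \<nu> phi \<le> (\<integral>\<^sup>+u. ennreal (\<bar>phi u\<bar> * \<bar>ln u\<bar> ^ 0) + ennreal (\<bar>phi u\<bar> * \<bar>ln u\<bar> ^ Suc r) \<partial>mellin_measure)"
      unfolding int_abs_moment_def
    proof (rule nn_integral_mono)
      fix u
      have "\<bar>phi u\<bar> * \<bar>ln u\<bar> ^ \<nu> \<le> \<bar>phi u\<bar> * \<bar>ln u\<bar> ^ 0 + \<bar>phi u\<bar> * \<bar>ln u\<bar> ^ Suc r"
        using mult_left_mono[OF power_le_one_plus_power[OF abs_ge_zero that], of "\<bar>phi u\<bar>" "ln u"]
        by (simp add: distrib_left)
      then show "ennreal (\<bar>phi u\<bar> * \<bar>ln u\<bar> ^ \<nu>) \<le> ennreal (\<bar>phi u\<bar> * \<bar>ln u\<bar> ^ 0) + ennreal (\<bar>phi u\<bar> * \<bar>ln u\<bar> ^ Suc r)"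
        by (subst ennreal_plus[symmetric]) (auto intro!: ennreal_leI simp del: ennreal_plus)
    qed
    also have "\<dots> = int_abs_moment 0 phi + int_abs_moment (Suc r) phi"
      unfolding int_abs_moment_def
    proof (rule nn_integral_add)
      have m: "(\<lambda>u. ennreal (\<bar>phi u\<bar> * \<bar>ln u\<bar> ^ n)) \<in> borel_measurable mellin_measure" for n
      proof -
        have "(\<lambda>u. \<bar>ln u\<bar> ^ n) \<in> borel_measurable mellin_measure"
          by (rule continuous_imp_measurable_mellin) (auto intro!: continuous_intros)
        then show ?thesis
          by (intro measurable_compose[OF _ measurable_ennreal] borel_measurable_times borel_measurable_abs phi)
      qed
      show "(\<lambda>u. ennreal (\<bar>phi u\<bar> * \<bar>ln u\<bar> ^ 0)) \<in> borel_measurable mellin_measure"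
        "(\<lambda>u. ennreal (\<bar>phi u\<bar> * \<bar>ln u\<bar> ^ Suc r)) \<in> borel_measurable mellin_measure"
        by (rule m)+
    qed
    also have "\<dots> < \<infinity>" using phi_fin by simp
    finally show "int_abs_moment \<nu> phi < \<infinity>" .
  qed

  have E_meas: "E k \<in> borel_measurable mellin_measure" for k
  proof (rule continuous_imp_measurable_mellin)
    have "(mellin_deriv ^^ 0) f \<in> {h. continuous_on {0<..} h}"
      using f unfolding mellin_C_def by blast
    then have "continuous_on {0<..} f" by simp
    then show "continuous_on {0<..} (E k)"
      unfolding E_def
      by (rule continuous_on_compose2) (auto intro!: continuous_intros simp: w[THEN less_imp_neq, symmetric])
  qed

  have err: "\<bar>E k u - (\<Sum>j\<le>r. c j * (ln u + d k) ^ j)\<bar>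
      \<le> P * (\<bar>ln u\<bar> ^ r + \<bar>d k\<bar> ^ r) + Q * (\<bar>ln u\<bar> ^ Suc r + \<bar>d k\<bar> ^ Suc r)" for k u
  proof -
    let ?t = "exp ((ln u + of_int k) / w)" and ?v = "ln u + d k"
    obtain n where n: "r = Suc n" using r by (cases r) auto
    have L: "ln ?t - ln x = ?v / w"
      using w by (simp add: d_def ln_u0 field_simps)
    \<comment> \<open>\<open>n = r - 1\<close> is the exponent of \<open>2\<close> in the convexity bound for \<open>r\<close>-th powers\<close>
    have "\<bar>E k u - (\<Sum>j\<le>r. c j * ?v ^ j)\<bar>
        = \<bar>f ?t - (\<Sum>j\<le>r. (mellin_deriv ^^ j) f x / fact j * (ln ?t - ln x) ^ j)\<bar>"
      unfolding L by (simp add: E_def c_def power_divide)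
    also have "\<dots> \<le> 2 * \<alpha> / fact r * \<bar>ln ?t - ln x\<bar> ^ r + \<beta> / fact (Suc r) * \<bar>ln ?t - ln x\<bar> ^ Suc r"
      by (rule mellin_taylor_smoothing_bound[OF f g r x _ \<alpha> \<beta>]) auto
    also have "\<dots> = 2 * \<alpha> / (fact r * w ^ r) * \<bar>?v\<bar> ^ r + \<beta> / (fact (Suc r) * w ^ Suc r) * \<bar>?v\<bar> ^ Suc r"
      unfolding L using w by (simp add: abs_divide power_divide del: power_Suc fact_Suc)
    also have "\<dots> \<le> 2 * \<alpha> / (fact r * w ^ r) * (2 ^ n * (\<bar>ln u\<bar> ^ r + \<bar>d k\<bar> ^ r))
        + \<beta> / (fact (Suc r) * w ^ Suc r) * (2 ^ r * (\<bar>ln u\<bar> ^ Suc r + \<bar>d k\<bar> ^ Suc r))"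
      using abs_add_power_le[of "ln u" "d k" n] abs_add_power_le[of "ln u" "d k" r] \<alpha>0 \<beta>0 w
      by (intro add_mono mult_left_mono) (simp_all add: n del: power_Suc fact_Suc)
    also have "\<dots> = P * (\<bar>ln u\<bar> ^ r + \<bar>d k\<bar> ^ r) + Q * (\<bar>ln u\<bar> ^ Suc r + \<bar>d k\<bar> ^ Suc r)"
    proof -
      have "2 * \<alpha> / (fact r * w ^ r) * 2 ^ n = P" by (simp add: P_def n)
      moreover have "\<beta> / (fact (Suc r) * w ^ Suc r) * 2 ^ r = Q" by (simp add: Q_def mult.commute)
      ultimately show ?thesis by (metis mult.assoc)
    qed
    finally show ?thesis .
  qed

  define S where "S \<nu> = (\<Sum>\<^sub>\<infinity>k. \<bar>a k\<bar> * \<bar>d k\<bar> ^ \<nu>)" for \<nu>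
  define I where "I \<nu> = (\<integral>u. \<bar>phi u\<bar> * \<bar>ln u\<bar> ^ \<nu> \<partial>mellin_measure)" for \<nu>
  have S: "S \<nu> \<le> Mc \<nu>" if "abs_moment \<nu> chi < \<infinity>" for \<nu>
    unfolding S_def a_def d_def Mc_def by (rule abs_moment_summable(2)[OF that u0])
  have I0: "I \<nu> \<ge> 0" for \<nu> unfolding I_def by simp
  have I: "I \<nu> = Mp \<nu>" if "int_abs_moment \<nu> phi < \<infinity>" for \<nu>
    using int_abs_moment_integrable(2)[OF phi that] I0[of \<nu>] by (simp add: Mp_def I_def)

  have "\<bar>(\<Sum>\<^sub>\<infinity>k. a k * (\<integral>u. phi u * E k u \<partial>mellin_measure))
       - (\<Sum>j\<le>r. c j * (\<Sum>\<eta>\<le>j. of_nat (j choose \<eta>) * (\<integral>u. phi u * ln u ^ (j - \<eta>) \<partial>mellin_measure)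
            * (\<Sum>\<^sub>\<infinity>k. a k * d k ^ \<eta>)))\<bar>
     \<le> P * (S 0 * I r + S r * I 0) + Q * (S 0 * I (Suc r) + S (Suc r) * I 0)"
    unfolding S_def I_def
    by (rule infsum_power_moment_expansion_error[OF E_meas chi_sum phi_int err])
  also have "\<dots> \<le> P * (Mc 0 * I r + Mc r * I 0) + Q * (Mc 0 * I (Suc r) + Mc (Suc r) * I 0)"
    by (intro add_mono mult_left_mono mult_right_mono S PQ I0 chi_fin chi_r)
  finally show ?thesis
    unfolding D I[OF phi_r] I[OF phi_fin(1)] I[OF phi_fin(2)]
    by (simp add: P_def Q_def c_def a_def d_def u0_def int_moment_def moment_def del: power_Suc fact_Suc)
qed

lemma ennreal_le_mult_INF:
  fixes F :: "'a \<Rightarrow> ennreal"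
  assumes c: "0 < c" and l: "0 \<le> l" and le: "\<And>g. g \<in> X \<Longrightarrow> ennreal l \<le> ennreal c * F g"
  shows "ennreal l \<le> ennreal c * (INF g\<in>X. F g)"
proof -
  have "ennreal (l / c) \<le> F g" if "g \<in> X" for g
  proof (cases "F g")
    case (real z)
    have "l \<le> c * z"
      using le[OF that] c l real by (simp add: ennreal_mult[symmetric])
    then show ?thesis using c real by (simp add: ennreal_leI field_simps)
  qed simp
  then have "ennreal c * ennreal (l / c) \<le> ennreal c * (INF g\<in>X. F g)"
    by (intro mult_left_mono INF_greatest) auto
  then show ?thesis using c l by (simp add: ennreal_mult[symmetric])
qed

theorem theorem4p3:
  fixes chi phi f :: "real \<Rightarrow> real" and r :: nat and w x :: real and A B :: ennreal
  assumes chi_cont: "continuous_on {0<..} chi"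
    and phi_L1: "integrable mellin_measure phi"
    and K1_chi: "\<And>u. u > 0 \<Longrightarrow>
      ((\<lambda>k::int. chi (exp (- of_int k) * u)) has_sum 1) UNIV"
    and K1_phi: "(\<integral>u. phi u \<partial>mellin_measure) = 1"
    and K2_moments: "abs_moment r chi + int_abs_moment r phi < \<infinity>"
    and K2_tail: "uniform_limit {0<..}
      (\<lambda>(\<gamma>::real) u. \<Sum>\<^sub>\<infinity>k\<in>{k::int. \<bar>of_int k - ln u\<bar> > \<gamma>}.
         \<bar>chi (exp (- of_int k) * u)\<bar> * \<bar>of_int k - ln u\<bar> ^ r) (\<lambda>_. 0) at_top"
    and chi_next: "abs_moment (r + 1) chi < \<infinity>"
    and phi_next: "int_abs_moment (r + 1) phi < \<infinity>"
    and r: "r \<ge> 1"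
    and f: "f \<in> mellin_C r"
    and A: "A = abs_moment 0 chi * int_abs_moment r phi + abs_moment r chi * int_abs_moment 0 phi"
    and B: "B = abs_moment 0 chi * int_abs_moment (r + 1) phi
                + abs_moment (r + 1) chi * int_abs_moment 0 phi"
    and x: "x > 0" and w: "w > 0"
  shows "ennreal \<bar>durrmeyer_sampling chi phi w f x - f x
            - (\<Sum>j=1..r. (mellin_deriv ^^ j) f x / (fact j * w ^ j) *
                (\<Sum>\<eta>=0..j. of_nat (j choose \<eta>) * int_moment (j - \<eta>) phi * moment \<eta> chi (x powr w)))\<bar>
         \<le> ennreal (2 ^ r / (fact r * w ^ r)) * A *
            peetre_K r f (ennreal (1 / (of_nat (r + 1) * w)) * (B / A))"
proof -
  define Mc where "Mc \<nu> = enn2real (abs_moment \<nu> chi)" for \<nu>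
  define Mp where "Mp \<nu> = enn2real (int_abs_moment \<nu> phi)" for \<nu>
  define A' where "A' = Mc 0 * Mp r + Mc r * Mp 0"
  define B' where "B' = Mc 0 * Mp (Suc r) + Mc (Suc r) * Mp 0"
  define X where "X = \<bar>durrmeyer_sampling chi phi w f x - f x
            - (\<Sum>j=1..r. (mellin_deriv ^^ j) f x / (fact j * w ^ j) *
                (\<Sum>\<eta>=0..j. of_nat (j choose \<eta>) * int_moment (j - \<eta>) phi * moment \<eta> chi (x powr w)))\<bar>"
  define N where "N = 2 ^ r / (fact r * w ^ r)"
  have phi_meas: "phi \<in> borel_measurable mellin_measure"
    using phi_L1 by (rule borel_measurable_integrable)
  have fin_r: "abs_moment r chi < \<infinity>" "int_abs_moment r phi < \<infinity>"
    using K2_moments by auto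
  have fin_0: "abs_moment 0 chi < \<infinity>" "int_abs_moment 0 phi < \<infinity>"
    using abs_moment_zero_finite[OF chi_cont fin_r(1)] phi_L1
    by (simp_all add: int_abs_moment_def integrable_iff_bounded)
  have fin_Suc: "abs_moment (Suc r) chi < \<infinity>" "int_abs_moment (Suc r) phi < \<infinity>"
    using chi_next phi_next by auto
  have chi_real: "abs_moment \<nu> chi = ennreal (Mc \<nu>)" if "abs_moment \<nu> chi < \<infinity>" for \<nu>
    using that by (simp add: Mc_def)
  have phi_real: "int_abs_moment \<nu> phi = ennreal (Mp \<nu>)" if "int_abs_moment \<nu> phi < \<infinity>" for \<nu>
    using that by (simp add: Mp_def)
  have nonneg: "Mc \<nu> \<ge> 0" "Mp \<nu> \<ge> 0" for \<nu>
    by (simp_all add: Mc_def Mp_def)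
  have A': "A = ennreal A'"
    unfolding A A'_def chi_real[OF fin_0(1)] chi_real[OF fin_r(1)] phi_real[OF fin_0(2)] phi_real[OF fin_r(2)]
    using nonneg by (simp add: ennreal_mult)
  have B': "B = ennreal B'"
    unfolding B B'_def Suc_eq_plus1[symmetric]
      chi_real[OF fin_0(1)] chi_real[OF fin_Suc(1)] phi_real[OF fin_0(2)] phi_real[OF fin_Suc(2)]
    using nonneg by (simp add: ennreal_mult)
  have B'_nonneg: "B' \<ge> 0" using nonneg by (simp add: B'_def)

  have "Mc 0 \<ge> 1"
  proof -
    have "1 = \<bar>\<Sum>\<^sub>\<infinity>k::int. chi (exp (- of_int k) * 1)\<bar>"
      using infsumI[OF K1_chi[of 1]] by simp
    also have "\<dots> \<le> (\<Sum>\<^sub>\<infinity>k::int. \<bar>chi (exp (- of_int k) * 1)\<bar>)"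
      using norm_infsum_bound[of "\<lambda>k::int. chi (exp (- of_int k) * 1)" UNIV]
        abs_moment_summable(1)[OF fin_0(1), of 1] by simp
    also have "\<dots> \<le> Mc 0"
      using abs_moment_summable(2)[OF fin_0(1), of 1] by (simp add: Mc_def)
    finally show ?thesis .
  qed
  moreover have "Mp r > 0"
    using int_abs_moment_pos[OF phi_meas, of r] K1_phi phi_real[OF fin_r(2)] nonneg(2)[of r]
    by (cases "Mp r = 0") auto
  ultimately have A'_pos: "A' > 0"
    using nonneg unfolding A'_def by (intro add_pos_nonneg mult_pos_pos mult_nonneg_nonneg) auto
  have N: "N > 0" using w by (simp add: N_def)

  have m0: "moment 0 chi (x powr w) = 1" "int_moment 0 phi = 1"
    using infsumI[OF K1_chi[of "x powr w"]] x K1_phi by (simp_all add: moment_def int_moment_def)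
  \<comment> \<open>the term \<open>f x\<close> is absorbed into the sum as its summand \<open>j = 0\<close>\<close>
  have X_eq: "X = \<bar>durrmeyer_sampling chi phi w f x
      - (\<Sum>j\<le>r. (mellin_deriv ^^ j) f x / (fact j * w ^ j) *
          (\<Sum>\<eta>\<le>j. of_nat (j choose \<eta>) * int_moment (j - \<eta>) phi * moment \<eta> chi (x powr w)))\<bar>"
    unfolding X_def atLeast0AtMost[symmetric] sum.atLeast_Suc_atMost[OF le0]
    by (simp add: m0 diff_diff_eq)

  have "ennreal X \<le> ennreal (N * A') * (INF g\<in>mellin_C (r + 1).
     sup_norm ((mellin_deriv ^^ r) (\<lambda>t. f t - g t)) +
     ennreal (1 / (of_nat (r + 1) * w)) * (B / A) * sup_norm ((mellin_deriv ^^ (r + 1)) g))"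
  proof (rule ennreal_le_mult_INF)
    show "0 < N * A'" using N A'_pos by simp
    show "0 \<le> X" by (simp add: X_def)
    fix g assume g: "g \<in> mellin_C (r + 1)"
    have coeff: "ennreal (1 / (of_nat (r + 1) * w)) * (B / A) = ennreal (1 / (of_nat (r + 1) * w) * (B' / A'))"
      unfolding A' B' divide_ennreal[OF B'_nonneg A'_pos]
      by (rule ennreal_mult[symmetric]) (use B'_nonneg A'_pos w in auto)
    have le_sup: "ennreal \<bar>h s\<bar> \<le> sup_norm h" if "s > 0" for h s
      unfolding sup_norm_def using that by (intro SUP_upper) auto
    have "(mellin_deriv ^^ (r + 1)) g \<in> log_C" using g unfolding mellin_C_def by blast
    then have "bounded ((mellin_deriv ^^ (r + 1)) g ` {0<..})" by (simp add: log_C_def)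
    then obtain C where "\<And>s. s > 0 \<Longrightarrow> \<bar>(mellin_deriv ^^ (r + 1)) g s\<bar> \<le> C"
      unfolding bounded_iff by auto
    then have "sup_norm ((mellin_deriv ^^ (r + 1)) g) \<le> ennreal C"
      unfolding sup_norm_def by (intro SUP_least ennreal_leI) auto
    then obtain \<beta> where \<beta>: "\<beta> \<ge> 0" "sup_norm ((mellin_deriv ^^ (r + 1)) g) = ennreal \<beta>"
      by (cases "sup_norm ((mellin_deriv ^^ (r + 1)) g)") (auto simp: top_unique)
    show "ennreal X \<le> ennreal (N * A') * (sup_norm ((mellin_deriv ^^ r) (\<lambda>t. f t - g t)) +
       ennreal (1 / (of_nat (r + 1) * w)) * (B / A) * sup_norm ((mellin_deriv ^^ (r + 1)) g))"
    proof (cases "sup_norm ((mellin_deriv ^^ r) (\<lambda>t. f t - g t))")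
      case top
      \<comment> \<open>the right-hand side is infinite, because \<open>N * A'\<close> is positive\<close>
      then show ?thesis using N A'_pos by (simp add: ennreal_mult_top)
    next
      case (real \<alpha>)
      have "X \<le> 2 ^ r * \<alpha> / (fact r * w ^ r) * (Mc 0 * Mp r + Mc r * Mp 0)
        + 2 ^ r * \<beta> / (fact (Suc r) * w ^ Suc r) * (Mc 0 * Mp (Suc r) + Mc (Suc r) * Mp 0)"
        unfolding X_eq Mc_def Mp_def
      proof (rule durrmeyer_taylor_smoothing_bound)
        show "\<bar>(mellin_deriv ^^ r) (\<lambda>t. f t - g t) s\<bar> \<le> \<alpha>" if "s > 0" for s
          using le_sup[OF that, of "(mellin_deriv ^^ r) (\<lambda>t. f t - g t)"] real by simp
        show "\<bar>(mellin_deriv ^^ Suc r) g s\<bar> \<le> \<beta>" if "s > 0" for s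
          using le_sup[OF that, of "(mellin_deriv ^^ (r + 1)) g"] \<beta> by (simp del: funpow.simps)
      qed (use phi_meas fin_0 fin_r fin_Suc r f g x w in auto)
      also have "\<dots> = N * A' * (\<alpha> + 1 / (of_nat (r + 1) * w) * (B' / A') * \<beta>)"
      proof -
        let ?Z = "1 / (of_nat (r + 1) * w) * (B' / A') * \<beta>"
        have fact_eq: "fact (Suc r) * w ^ Suc r = (fact r * w ^ r) * (of_nat (r + 1) * w)"
          by (simp add: mult_ac)
        have "2 ^ r * \<beta> / (fact (Suc r) * w ^ Suc r) * B'
            = 2 ^ r / (fact r * w ^ r) * (1 / (of_nat (r + 1) * w) * B' * \<beta>)"
          unfolding fact_eq by (simp add: mult_ac)
        also have "1 / (of_nat (r + 1) * w) * B' * \<beta> = A' * ?Z"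
          using A'_pos by simp
        finally have "2 ^ r * \<beta> / (fact (Suc r) * w ^ Suc r) * B' = 2 ^ r / (fact r * w ^ r) * (A' * ?Z)" .
        moreover have "2 ^ r * \<alpha> / (fact r * w ^ r) * A' = 2 ^ r / (fact r * w ^ r) * (A' * \<alpha>)"
          by simp
        ultimately show ?thesis
          unfolding A'_def[symmetric] B'_def[symmetric] N_def by (simp only: distrib_left mult.assoc)
      qed
      finally have "ennreal X \<le> ennreal (N * A' * (\<alpha> + 1 / (of_nat (r + 1) * w) * (B' / A') * \<beta>))"
        by (rule ennreal_leI)
      also have "\<dots> = ennreal (N * A') * (ennreal \<alpha> + ennreal (1 / (of_nat (r + 1) * w) * (B' / A')) * ennreal \<beta>)"
      proof -
        let ?e = "1 / (of_nat (r + 1) * w) * (B' / A')"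
        have e: "?e \<ge> 0" using B'_nonneg A'_pos w by simp
        have "ennreal (N * A' * (\<alpha> + ?e * \<beta>)) = ennreal (N * A') * ennreal (\<alpha> + ?e * \<beta>)"
          by (rule ennreal_mult[OF _ add_nonneg_nonneg[OF real(1) mult_nonneg_nonneg[OF e \<beta>(1)]]])
            (use N A'_pos in simp)
        also have "ennreal (\<alpha> + ?e * \<beta>) = ennreal \<alpha> + ennreal (?e * \<beta>)"
          by (rule ennreal_plus[OF real(1) mult_nonneg_nonneg[OF e \<beta>(1)]])
        also have "ennreal (?e * \<beta>) = ennreal ?e * ennreal \<beta>"
          by (rule ennreal_mult[OF e \<beta>(1)])
        finally show ?thesis .
      qed
      finally show ?thesis unfolding coeff \<beta>(2) real(2) .
    qed
  qed
  moreover have "ennreal (N * A') = ennreal N * A"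
    using N A'_pos by (simp add: A' ennreal_mult)
  ultimately show ?thesis
    unfolding peetre_K_def X_def N_def by simp
qed

end
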